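(* Let $C\in\mathbb{R}^{(m+p)\times n}$. Assume that $\mathrm{rank}(QC^TCQ^T)=r$ with $r<\min(m+p,q)$ and that $P\in\mathbb{S}_+^n$ is factorized as $P=Q^TQ$, where $Q\in\mathbb{R}^{q\times n}$ has rank $q$. Further, assume that $\Phi\in\mathbb{R}^{q\times r}$ is an orthonormal basis for $\mathcal{R}(QC^T)$ (that is, its columns form such a basis). Then a matrix $D$ with $(D^TD)^{-1}\in\mathcal{L}$ that minimizes the ratio $$\frac{\lambda_1(DCPC^TD^T)}{\lambda_r(DCPC^TD^T)}$$ over all $D$ with $(D^TD)^{-1}\in\mathcal{L}$ can be computed by solving the semi-definite program $$\text{minimize } -t\quad\text{subject to}\quad QC^TMCQ^T\preceq I,\quad \Phi^TQC^TMCQ^T\Phi\succeq tI,\quad M\in\mathcal{L},$$ in the variables $t\in\mathbb{R}$ and $M$, where $M=D^TD$. Further, $\mathbf{L}=(D^TD)^{-1}\succeq CPC^T$.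
   Context: $\mathbb{S}_+^k$ and $\mathbb{S}_{++}^k$ are the sets of symmetric positive semidefinite, respectively positive definite, real $k\times k$ matrices; $L\succeq M$ (equivalently $M\preceq L$) means that $L-M$ is symmetric positive semidefinite. $\mathcal{R}(X)$ denotes the range of a matrix $X$. $\lambda_1(DCPC^TD^T)$ and $\lambda_r(DCPC^TD^T)$ denote the largest and the smallest non-zero eigenvalue of $DCPC^TD^T$, respectively. The set $\mathcal{L}$ encodes structural constraints: let $\mathbb{L}$ be a set of index pairs $(i,j)$, $i,j\in\{1,\dots,m+p\}$, for which $\mathbf{L}_{ij}$ may be non-zero; then $$\mathcal{L}=\{\mathbf{L}\in\mathbb{S}_{++}^{m+p}\ :\ \mathbf{L}=(D^TD)^{-1},\ D\in\mathbb{R}^{(m+p)\times(m+p)}\text{ invertible},\ \mathbf{L}_{ij}=[\mathbf{L}^{-1}]_{ij}=[D^{-1}]_{ij}=0\text{ if }(i,j)\notin\mathbb{L}\}.$$ Diagonal, block-diagonal and full structures can be represented in this way; for instance, $\mathbb{L}=\{(1,1),(2,2),\dots,(m+p,m+p)\}$ restricts $\mathbf{L}\in\mathcal{L}$ to be diagonal.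
   Formalization: It is additionally assumed that the set L is closed under matrix inversion (true for diagonal, block-diagonal and full structures; the claim fails for some index sets otherwise). Existence of a minimizing D is not asserted, since the minimum need not be attained. *)

theory Defs
  imports "HOL-Analysis.Analysis"
begin

definition psd :: "real^'n^'n \<Rightarrow> bool" where
  "psd A \<longleftrightarrow> transpose A = A \<and> (\<forall>x. 0 \<le> x \<bullet> (A *v x))"

definition posdef :: "real^'n^'n \<Rightarrow> bool" where
  "posdef A \<longleftrightarrow> transpose A = A \<and> (\<forall>x. x \<noteq> 0 \<longrightarrow> 0 < x \<bullet> (A *v x))"

definition loewner_le :: "real^'n^'n \<Rightarrow> real^'n^'n \<Rightarrow> bool"  (infix \<open>\<preceq>\<close> 50) where
  "M \<preceq> L \<longleftrightarrow> psd (L - M)"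

definition eigenvalues :: "real^'n^'n \<Rightarrow> real set" where
  "eigenvalues A = {l. \<exists>v. v \<noteq> 0 \<and> A *v v = l *\<^sub>R v}"

definition largest_eigenvalue :: "real^'n^'n \<Rightarrow> real" where
  "largest_eigenvalue A = Max (eigenvalues A)"

definition smallest_nonzero_eigenvalue :: "real^'n^'n \<Rightarrow> real" where
  "smallest_nonzero_eigenvalue A = Min (eigenvalues A - {0})"

definition orthonormal_basis_of :: "real^'r^'q \<Rightarrow> (real^'q) set \<Rightarrow> bool" where
  "orthonormal_basis_of \<Phi> V \<longleftrightarrow>
     (\<forall>i j. column i \<Phi> \<bullet> column j \<Phi> = (if i = j then 1 else 0)) \<and> span (columns \<Phi>) = V"

text \<open>
  The set of metrics with structure given by the index set S. Note that S need not be
  symmetric, and that the factor D is not determined by L.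
\<close>

definition structured :: "('k \<times> 'k) set \<Rightarrow> (real^'k^'k) set" where
  "structured S = {L. posdef L \<and>
     (\<exists>D. invertible D \<and> L = matrix_inv (transpose D ** D) \<and>
        (\<forall>i j. (i, j) \<notin> S \<longrightarrow>
           L $ i $ j = 0 \<and> matrix_inv L $ i $ j = 0 \<and> matrix_inv D $ i $ j = 0))}"

text \<open>
  Invertibility is stated explicitly because \<^const>\<open>matrix_inv\<close> is unspecified on singular
  matrices.
\<close>

definition admissible :: "('k \<times> 'k) set \<Rightarrow> real^'k^'k \<Rightarrow> bool" where
  "admissible S D \<longleftrightarrow> invertible D \<and> matrix_inv (transpose D ** D) \<in> structured S"

definition eigenvalue_ratio :: "real^'n^'k \<Rightarrow> real^'n^'n \<Rightarrow> real^'k^'k \<Rightarrow> real" where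
  "eigenvalue_ratio C P D =
     (let A = D ** C ** P ** transpose C ** transpose D
      in largest_eigenvalue A / smallest_nonzero_eigenvalue A)"

definition minimizes_ratio ::
  "('k \<times> 'k) set \<Rightarrow> real^'n^'k \<Rightarrow> real^'n^'n \<Rightarrow> real^'k^'k \<Rightarrow> bool" where
  "minimizes_ratio S C P D \<longleftrightarrow> is_arg_min (eigenvalue_ratio C P) (admissible S) D"

definition sdp_feasible ::
  "('k \<times> 'k) set \<Rightarrow> real^'n^'k \<Rightarrow> real^'n^'q \<Rightarrow> real^'r^'q \<Rightarrow> real \<times> (real^'k^'k) \<Rightarrow> bool" where
  "sdp_feasible S C Q \<Phi> = (\<lambda>(t, M).
     Q ** transpose C ** M ** C ** transpose Q \<preceq> mat 1 \<and>
     t *\<^sub>R mat 1 \<preceq> transpose \<Phi> ** Q ** transpose C ** M ** C ** transpose Q ** \<Phi> \<and>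
     M \<in> structured S)"

definition sdp_optimal ::
  "('k \<times> 'k) set \<Rightarrow> real^'n^'k \<Rightarrow> real^'n^'q \<Rightarrow> real^'r^'q \<Rightarrow> real \<times> (real^'k^'k) \<Rightarrow> bool" where
  "sdp_optimal S C Q \<Phi> z \<longleftrightarrow> is_arg_min (\<lambda>(t, M). - t) (sdp_feasible S C Q \<Phi>) z"

text \<open>
  The ratio is minimized over D with the inverse of \<open>transpose D ** D\<close> in the structured set,
  while the program constrains \<open>M = transpose D ** D\<close> itself to lie in it. The two agree only
  if the set is closed under inversion. This fails for some index sets, because a sparse factor
  of L does not in general yield one of the inverse of L. It holds for every block-diagonal
  structure up to a permutation (S an equivalence relation), which includes the diagonal
  (\<open>S = Id\<close>) and the full (\<open>S = UNIV\<close>) structure.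
\<close>

definition inverse_closed :: "('k::finite \<times> 'k) set \<Rightarrow> bool" where
  "inverse_closed S \<longleftrightarrow> (\<forall>L \<in> structured S. matrix_inv L \<in> structured S)"

lemma matrix_inv_both:
  fixes A :: "real^'k^'k"
  assumes "invertible A"
  shows "A ** matrix_inv A = mat 1" "matrix_inv A ** A = mat 1"
  using someI_ex[OF assms[unfolded invertible_def]] unfolding matrix_inv_def by auto

lemma matrix_inv_eqI:
  fixes A B :: "real^'k^'k"
  assumes "A ** B = mat 1"
  shows "matrix_inv A = B"
proof -
  have "invertible A"
    unfolding invertible_def using assms matrix_left_right_inverse[THEN iffD1, OF assms]
    by (intro exI[of _ B] conjI)
  have "matrix_inv A = matrix_inv A ** (A ** B)" by (simp add: assms)
  also have "\<dots> = (matrix_inv A ** A) ** B" by (simp only: matrix_mul_assoc)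
  also have "\<dots> = B" by (simp add: matrix_inv_both(2)[OF \<open>invertible A\<close>])
  finally show ?thesis .
qed

lemma matrix_inv_block_pattern:
  fixes A :: "real^'k^'k"
  assumes S: "equiv UNIV S" and inv: "invertible A"
    and pat: "\<And>i j. (i, j) \<notin> S \<Longrightarrow> A $ i $ j = 0"
    and ij: "(i, j) \<notin> S"
  shows "matrix_inv A $ i $ j = 0"
proof -
  define x where "x = matrix_inv A *v axis j 1"
  define x' where "x' = (\<chi> k. if (k, j) \<in> S then x $ k else 0)"
  have sym: "(b, a) \<in> S" if "(a, b) \<in> S" for a b
    using S that unfolding equiv_def by (meson symD)
  have trans: "(a, c) \<in> S" if "(a, b) \<in> S" "(b, c) \<in> S" for a b c
    using S that unfolding equiv_def by (meson transD)
  have refl: "(a, a) \<in> S" for a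
    using S unfolding equiv_def by (meson UNIV_I refl_onD)
  have Ax: "A *v x = axis j 1"
    by (simp add: x_def matrix_vector_mul_assoc matrix_inv_both(1)[OF inv])
  have "(A *v x') $ l = axis j 1 $ l" for l
  proof (cases "(l, j) \<in> S")
    case True
    have "A $ l $ k * x' $ k = A $ l $ k * x $ k" for k
      using pat[of l k] trans[OF sym[of l k] True] by (cases "(l, k) \<in> S") (auto simp: x'_def)
    then have "(A *v x') $ l = (A *v x) $ l"
      unfolding matrix_vector_mult_def by (simp only: vec_lambda_beta)
    then show ?thesis by (simp add: Ax)
  next
    case False
    have "A $ l $ k * x' $ k = 0" for k
      using pat[of l k] trans[of l k j] False by (auto simp: x'_def)
    then have "(A *v x') $ l = 0"
      unfolding matrix_vector_mult_def by (simp only: vec_lambda_beta sum.neutral_const)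
    moreover have "l \<noteq> j" using False refl by auto
    ultimately show ?thesis by (simp add: axis_def)
  qed
  then have "A *v x' = A *v x" by (simp add: Ax vec_eq_iff)
  then have "x' = x"
    using inj_matrix_vector_mult[OF inv] by (simp add: inj_def)
  then have "x $ i = 0"
    using ij arg_cong[OF \<open>x' = x\<close>, of "\<lambda>v. v $ i"]
    unfolding x'_def vec_lambda_beta by simp
  then show ?thesis
    by (simp add: x_def matrix_vector_mul_component inner_axis)
qed

lemma inverse_closed_block_diagonal:
  fixes S :: "('k::finite \<times> 'k) set"
  assumes S: "equiv UNIV S"
  shows "inverse_closed S"
  unfolding inverse_closed_def
proof
  fix L :: "real^'k^'k"
  assume "L \<in> structured S"
  then obtain D where pd: "posdef L" and D: "invertible D"
    and L: "L = matrix_inv (transpose D ** D)"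
    and pat: "\<And>i j. (i, j) \<notin> S \<Longrightarrow>
      L $ i $ j = 0 \<and> matrix_inv L $ i $ j = 0 \<and> matrix_inv D $ i $ j = 0"
    unfolding structured_def by blast
  define E where "E = matrix_inv D"
  have DE: "D ** E = mat 1" "E ** D = mat 1"
    using matrix_inv_both[OF D] by (simp_all add: E_def)
  have DEt: "transpose D ** transpose E = mat 1" "transpose E ** transpose D = mat 1"
    using arg_cong[OF DE(2), of transpose] arg_cong[OF DE(1), of transpose]
    by (simp_all add: matrix_transpose_mul transpose_mat)
  have "(transpose D ** D) ** (E ** transpose E) = transpose D ** (D ** E) ** transpose E"
    by (simp only: matrix_mul_assoc)
  then have DDEE: "(transpose D ** D) ** (E ** transpose E) = mat 1"
    by (simp add: DE DEt)
  have LE: "L = E ** transpose E"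
    unfolding L by (rule matrix_inv_eqI[OF DDEE])
  have LL: "L ** (transpose D ** D) = mat 1"
    unfolding LE by (rule matrix_left_right_inverse[THEN iffD1, OF DDEE])
  have Linv: "matrix_inv L = transpose D ** D"
    by (rule matrix_inv_eqI[OF LL])
  have Linv2: "matrix_inv (matrix_inv L) = L"
    unfolding Linv by (simp add: L)
  have Einv: "invertible E" unfolding invertible_def using DE by (intro exI[of _ D] conjI)
  have Dpat: "D $ i $ j = 0" if "(i, j) \<notin> S" for i j
  proof -
    have "matrix_inv E = D" by (rule matrix_inv_eqI[OF DE(2)])
    then show ?thesis
      using matrix_inv_block_pattern[OF S Einv _ that] pat unfolding E_def by simp
  qed
  have pd': "posdef (matrix_inv L)"
    unfolding posdef_def Linv
  proof (intro conjI allI impI)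
    show "transpose (transpose D ** D) = transpose D ** D"
      by (simp add: matrix_transpose_mul transpose_transpose)
    fix x :: "real^'k" assume "x \<noteq> 0"
    then have "D *v x \<noteq> 0"
      using inj_matrix_vector_mult[OF D] by (metis injD matrix_vector_mult_0_right)
    then have "0 < (D *v x) \<bullet> (D *v x)" by simp
    also have "\<dots> = x \<bullet> (transpose D ** D *v x)"
      by (simp only: matrix_vector_mul_assoc[symmetric] transpose_matrix_vector
          inner_commute[of x] dot_lmul_matrix)
    finally show "0 < x \<bullet> (transpose D ** D *v x)" .
  qed
  have "invertible (transpose E)" unfolding invertible_def using DEt by (intro exI[of _ "transpose D"] conjI)
  moreover have "matrix_inv L = matrix_inv (transpose (transpose E) ** transpose E)"
    by (simp add: LE)
  moreover have "matrix_inv (transpose E) = transpose D"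
    by (rule matrix_inv_eqI[OF DEt(2)])
  moreover have "transpose D $ i $ j = 0" if "(i, j) \<notin> S" for i j
  proof -
    have "(j, i) \<notin> S" using S that unfolding equiv_def by (meson symD)
    then show ?thesis by (simp add: transpose_def Dpat)
  qed
  ultimately show "matrix_inv L \<in> structured S"
    unfolding structured_def using pd' pat Linv2
    by (intro CollectI conjI exI[of _ "transpose E"]) auto
qed

end

theory Submission
  imports Defs
begin

text \<open>
  Put \<open>X = D ** C ** transpose Q\<close>. As \<open>P = transpose Q ** Q\<close>, the matrix in the ratio is
  \<open>X ** transpose X\<close>, and it has the same non-zero eigenvalues as the Gram matrix
  \<open>N = transpose X ** X\<close>. With \<open>M = transpose D ** D\<close> this \<open>N\<close> is the matrix
  \<open>Q ** transpose C ** M ** C ** transpose Q\<close> of the program, which is linear in \<open>M\<close>.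

  The largest eigenvalue of \<open>N\<close> is at most \<open>c\<close> exactly if \<open>N\<close> lies below \<open>c\<close> times the identity.
  The smallest non-zero one is at least \<open>t\<close> exactly if the quadratic form of \<open>N\<close> is at least \<open>t\<close>
  times the squared norm on the range of \<open>transpose X\<close>; since \<open>D\<close> is invertible, that
  range is the range of \<open>Q ** transpose C\<close>, whatever \<open>D\<close> is, and \<open>\<Phi>\<close> parametrizes it
  isometrically. So \<open>(t, M)\<close> is feasible exactly if \<open>M\<close> is structured, the largest eigenvalue is
  at most 1 and the smallest non-zero one is at least \<open>t\<close> (\<open>sdp_feasible_scaled_iff\<close>). Both
  eigenvalues are homogeneous in \<open>M\<close>, and so is the structure. Hence any structured \<open>M\<close> can be
  rescaled so that its largest eigenvalue is 1; the best \<open>t\<close> is then the reciprocal of the ratio,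
  and maximizing \<open>t\<close> is minimizing the ratio.

  The final inequality says that \<open>X ** transpose X\<close> lies below the identity, while the program
  says this of \<open>transpose X ** X\<close>. Both mean that \<open>X\<close> is a contraction.
\<close>

section \<open>Eigenvalues of symmetric matrices\<close>

\<comment> \<open>The form \<open>transpose A *v x\<close> is kept, so that products associate into Gram matrices.\<close>
declare transpose_matrix_vector [simp del]

lemma inner_transpose_mult:
  fixes A :: "real^'n^'m"
  shows "x \<bullet> (transpose A *v y) = (A *v x) \<bullet> y"
  by (simp add: transpose_matrix_vector dot_lmul_matrix inner_commute[of _ y] inner_commute[of x "y v* A"])

lemma inner_gram_mult:
  fixes A :: "real^'n^'m"
  shows "x \<bullet> ((transpose A ** A) *v y) = (A *v x) \<bullet> (A *v y)"
  by (simp add: matrix_vector_mul_assoc[symmetric] inner_transpose_mult)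

lemma inner_symmetric_mult:
  fixes A :: "real^'n^'n"
  assumes "transpose A = A"
  shows "x \<bullet> (A *v y) = (A *v x) \<bullet> y"
  using inner_transpose_mult[of x A y] assms by simp

text \<open>Eigenvectors to distinct eigenvalues are orthogonal, hence independent.\<close>

lemma finite_eigenvalues_symmetric:
  fixes A :: "real^'n^'n"
  assumes sym: "transpose A = A"
  shows "finite (eigenvalues A)"
proof -
  have "\<forall>l \<in> eigenvalues A. \<exists>v. v \<noteq> 0 \<and> A *v v = l *\<^sub>R v"
    by (simp add: eigenvalues_def)
  then obtain v where v: "\<And>l. l \<in> eigenvalues A \<Longrightarrow> v l \<noteq> 0 \<and> A *v v l = l *\<^sub>R v l"
    by metis
  have orth: "v l \<bullet> v m = 0" if "l \<in> eigenvalues A" "m \<in> eigenvalues A" "l \<noteq> m" for l m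
  proof -
    have "m * (v l \<bullet> v m) = l * (v l \<bullet> v m)"
      using inner_symmetric_mult[OF sym, of "v l" "v m"] v that by simp
    then show ?thesis using that by simp
  qed
  have inj: "inj_on v (eigenvalues A)"
    by (rule inj_onI) (metis orth v inner_eq_zero_iff)
  have "pairwise orthogonal (v ` eigenvalues A)"
    unfolding pairwise_def orthogonal_def using orth by auto
  moreover have "0 \<notin> v ` eigenvalues A" using v by force
  ultimately have "independent (v ` eigenvalues A)"
    by (rule pairwise_orthogonal_independent)
  then have "finite (v ` eigenvalues A)" by (rule independent_imp_finite)
  then show ?thesis using inj by (simp add: finite_image_iff)
qed

text \<open>
  A linear function dominated by a quadratic one vanishes. This is the first-order condition
  at an extremum of a quadratic form.
\<close>

lemma linear_dominated_by_quadratic: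
  fixes a b :: real
  assumes "\<And>s. s * a \<le> s\<^sup>2 * b"
  shows "a = 0"
proof (rule ccontr)
  assume "a \<noteq> 0"
  \<comment> \<open>of the sign of \<open>a\<close>, and small enough for the quadratic term not to catch up\<close>
  define s where "s = a / (\<bar>b\<bar> + 1)"
  have "s * a = a\<^sup>2 / (\<bar>b\<bar> + 1)" by (simp add: s_def power2_eq_square)
  moreover have "s\<^sup>2 * b = (a\<^sup>2 / (\<bar>b\<bar> + 1)) * (b / (\<bar>b\<bar> + 1))"
    by (simp add: s_def power2_eq_square)
  moreover have "b / (\<bar>b\<bar> + 1) < 1" by simp
  moreover have "a\<^sup>2 / (\<bar>b\<bar> + 1) > 0" using \<open>a \<noteq> 0\<close> by simp
  ultimately show False using assms[of s] by (smt (verit) mult_less_cancel_left2)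
qed

text \<open>
  The quadratic form attains its maximum over the unit sphere of an invariant subspace, and the
  first-order condition makes the maximizer an eigenvector.
\<close>

lemma rayleigh_max_eigenvector:
  fixes A :: "real^'n^'n"
  assumes sym: "transpose A = A" and V: "subspace V" and nz: "\<exists>x\<in>V. x \<noteq> 0"
    and inv: "\<And>x. x \<in> V \<Longrightarrow> A *v x \<in> V"
  obtains l v where "v \<in> V" "v \<noteq> 0" "A *v v = l *\<^sub>R v"
    "\<And>x. x \<in> V \<Longrightarrow> x \<bullet> (A *v x) \<le> l * (x \<bullet> x)"
proof -
  let ?U = "sphere 0 1 \<inter> V"
  have unit: "(1 / norm x) *\<^sub>R x \<in> ?U" if "x \<in> V" "x \<noteq> 0" for x
    using that V by (simp add: subspace_scale)
  have "compact ?U"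
    using closed_subspace[OF V] by (intro compact_Int_closed) auto
  moreover have "?U \<noteq> {}" using nz unit by blast
  moreover have "continuous_on ?U (\<lambda>x. x \<bullet> (A *v x))"
    by (intro continuous_intros matrix_vector_mult_linear_continuous_on)
  ultimately obtain v where v: "v \<in> ?U" and
    max: "\<And>x. x \<in> ?U \<Longrightarrow> x \<bullet> (A *v x) \<le> v \<bullet> (A *v v)"
    using continuous_attains_sup[of ?U "\<lambda>x. x \<bullet> (A *v x)"] by blast
  define l where "l = v \<bullet> (A *v v)"
  have vV: "v \<in> V" and vv: "v \<bullet> v = 1" using v by (auto simp: norm_eq_1)
  have le: "x \<bullet> (A *v x) \<le> l * (x \<bullet> x)" if "x \<in> V" for x
  proof (cases "x = 0")
    case False
    then have n: "norm x > 0" by simp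
    have "((1 / norm x) *\<^sub>R x) \<bullet> (A *v ((1 / norm x) *\<^sub>R x)) \<le> l"
      unfolding l_def by (rule max[OF unit[OF that False]])
    then have "(x \<bullet> (A *v x)) / (norm x)\<^sup>2 \<le> l"
      by (simp add: matrix_vector_mult_scaleR power2_eq_square)
    then show ?thesis
      using n by (simp add: pos_divide_le_eq dot_square_norm)
  qed simp
  \<comment> \<open>Moving from \<open>v\<close> along its eigenvector residual \<open>w\<close> would exceed the maximum at rate
    \<open>2 * (w \<bullet> w)\<close>.\<close>
  define w where "w = A *v v - l *\<^sub>R v"
  have wV: "w \<in> V" unfolding w_def by (intro subspace_diff subspace_scale V inv vV)
  have "s * (2 * (w \<bullet> w)) \<le> s\<^sup>2 * (l * (w \<bullet> w) - w \<bullet> (A *v w))" for s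
  proof -
    have "(v + s *\<^sub>R w) \<bullet> (A *v (v + s *\<^sub>R w)) \<le> l * ((v + s *\<^sub>R w) \<bullet> (v + s *\<^sub>R w))"
      by (intro le subspace_add subspace_scale V vV wV)
    moreover have "(v + s *\<^sub>R w) \<bullet> (A *v (v + s *\<^sub>R w))
        = v \<bullet> (A *v v) + s * (v \<bullet> (A *v w)) + s * (w \<bullet> (A *v v)) + s\<^sup>2 * (w \<bullet> (A *v w))"
      by (simp add: matrix_vector_right_distrib matrix_vector_mult_scaleR inner_add_left
          inner_add_right distrib_left power2_eq_square)
    moreover have "(v + s *\<^sub>R w) \<bullet> (v + s *\<^sub>R w) = 1 + 2 * (s * (w \<bullet> v)) + s\<^sup>2 * (w \<bullet> w)"
      by (simp add: inner_add_left inner_add_right distrib_left power2_eq_square vv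
          inner_commute[of v w])
    moreover have "v \<bullet> (A *v w) = w \<bullet> (A *v v)"
      using inner_symmetric_mult[OF sym, of v w] by (simp add: inner_commute[of w])
    moreover have "w \<bullet> (A *v v) = w \<bullet> w + l * (w \<bullet> v)"
    proof -
      have "A *v v = w + l *\<^sub>R v" by (simp add: w_def)
      then show ?thesis by (simp only: inner_add_right inner_scaleR_right)
    qed
    ultimately have "l + s * (w \<bullet> w + l * (w \<bullet> v)) + s * (w \<bullet> w + l * (w \<bullet> v))
        + s\<^sup>2 * (w \<bullet> (A *v w))
        \<le> l * (1 + 2 * (s * (w \<bullet> v)) + s\<^sup>2 * (w \<bullet> w))"
      by (simp only: l_def[symmetric])
    then show ?thesis by (simp add: algebra_simps)
  qed
  then have "2 * (w \<bullet> w) = 0" by (rule linear_dominated_by_quadratic)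
  then have "A *v v = l *\<^sub>R v" by (simp add: w_def)
  moreover have "v \<noteq> 0" using vv by auto
  ultimately show thesis using vV le by (intro that[of v l])
qed

lemma eigenvalues_mult_commute:
  fixes X :: "real^'q^'k" and Y :: "real^'k^'q"
  shows "eigenvalues (X ** Y) - {0} = eigenvalues (Y ** X) - {0}"
proof -
  have sub: "eigenvalues (X ** Y) - {0} \<subseteq> eigenvalues (Y ** X) - {0}"
    for X :: "real^'a^'b" and Y :: "real^'b^'a"
  proof
    fix l assume "l \<in> eigenvalues (X ** Y) - {0}"
    then obtain v where "v \<noteq> 0" "l \<noteq> 0" and v: "X *v (Y *v v) = l *\<^sub>R v"
      by (auto simp: eigenvalues_def matrix_vector_mul_assoc[symmetric])
    then have "Y *v v \<noteq> 0" by auto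
    moreover have "(Y ** X) *v (Y *v v) = l *\<^sub>R (Y *v v)"
      by (simp add: v matrix_vector_mul_assoc[symmetric] matrix_vector_mult_scaleR)
    ultimately show "l \<in> eigenvalues (Y ** X) - {0}"
      using \<open>l \<noteq> 0\<close> by (auto simp: eigenvalues_def)
  qed
  show ?thesis using sub[of X Y] sub[of Y X] by blast
qed

section \<open>Extreme non-zero eigenvalues of a Gram matrix\<close>

lemma symmetric_gram: "transpose (transpose X ** X) = transpose X ** (X :: real^'q^'k)"
  by (simp add: matrix_transpose_mul)

lemma gram_eigenvector:
  fixes X :: "real^'q^'k"
  assumes "l \<in> eigenvalues (transpose X ** X) - {0}"
  obtains v where "v \<noteq> 0" "(norm (X *v v))\<^sup>2 = l * (norm v)\<^sup>2" "v \<in> range ((*v) (transpose X))"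
proof -
  obtain v where "v \<noteq> 0" "l \<noteq> 0" and v: "(transpose X ** X) *v v = l *\<^sub>R v"
    using assms by (auto simp: eigenvalues_def)
  have "(norm (X *v v))\<^sup>2 = l * (norm v)\<^sup>2"
    using inner_gram_mult[of v X v] v by (simp add: dot_square_norm)
  moreover have "v = transpose X *v ((1 / l) *\<^sub>R (X *v v))"
    using v \<open>l \<noteq> 0\<close> by (simp add: matrix_vector_mult_scaleR matrix_vector_mul_assoc)
  ultimately show thesis using that \<open>v \<noteq> 0\<close> by blast
qed

lemma gram_eigenvalue_pos:
  fixes X :: "real^'q^'k"
  assumes "l \<in> eigenvalues (transpose X ** X) - {0}"
  shows "0 < l"
proof -
  obtain v where "v \<noteq> 0" and v: "(norm (X *v v))\<^sup>2 = l * (norm v)\<^sup>2"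
    using gram_eigenvector[OF assms] by metis
  then have "0 \<le> l * (norm v)\<^sup>2" by (metis zero_le_power2)
  then have "0 \<le> l" using \<open>v \<noteq> 0\<close> by (simp add: zero_le_mult_iff)
  then show ?thesis using assms by simp
qed

lemma gram_max_eigenvalue:
  fixes X :: "real^'q^'k"
  assumes nz: "\<exists>x. X *v x \<noteq> 0"
  obtains l where "l \<in> eigenvalues (transpose X ** X) - {0}"
    "\<And>x. (norm (X *v x))\<^sup>2 \<le> l * (norm x)\<^sup>2"
proof -
  obtain x0 where x0: "X *v x0 \<noteq> 0" using nz by blast
  then have "x0 \<noteq> 0" by auto
  then obtain l v where v: "v \<noteq> 0" "(transpose X ** X) *v v = l *\<^sub>R v"
    and le: "\<And>x. x \<bullet> ((transpose X ** X) *v x) \<le> l * (x \<bullet> x)"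
    using rayleigh_max_eigenvector[OF symmetric_gram[of X] subspace_UNIV] by (metis UNIV_I)
  have le: "(norm (X *v x))\<^sup>2 \<le> l * (norm x)\<^sup>2" for x
    using le[of x] by (simp add: inner_gram_mult dot_square_norm)
  then have "l \<noteq> 0" using x0 le[of x0] by auto
  then have "l \<in> eigenvalues (transpose X ** X) - {0}" using v by (auto simp: eigenvalues_def)
  then show thesis using that le by blast
qed

text \<open>
  On the row space the Gram matrix is injective, so the minimum of its quadratic form there is
  attained at an eigenvector with non-zero eigenvalue.
\<close>

lemma gram_min_eigenvalue:
  fixes X :: "real^'q^'k"
  assumes nz: "\<exists>x. X *v x \<noteq> 0"
  obtains l where "l \<in> eigenvalues (transpose X ** X) - {0}"
    "\<And>x. x \<in> range ((*v) (transpose X)) \<Longrightarrow> l * (norm x)\<^sup>2 \<le> (norm (X *v x))\<^sup>2"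
proof -
  let ?V = "range ((*v) (transpose X))"
  let ?N = "transpose X ** X"
  have neg: "(- ?N) *v x = - (?N *v x)" for x
    by (simp add: vec_eq_iff matrix_vector_mult_def sum_negf)
  have V: "subspace ?V" by (rule linear_subspace_image[OF _ subspace_UNIV]) simp
  have inj: "x = 0" if "x \<in> ?V" "X *v x = 0" for x
  proof -
    obtain y where "x = transpose X *v y" using \<open>x \<in> ?V\<close> by blast
    then have "x \<bullet> x = (X *v x) \<bullet> y" using inner_transpose_mult[of x X y] by simp
    then show ?thesis using that by simp
  qed
  have inV: "?N *v x \<in> ?V" for x by (auto simp: matrix_vector_mul_assoc[symmetric])
  obtain x0 where x0: "X *v x0 \<noteq> 0" using nz by blast
  have "x0 \<bullet> (?N *v x0) \<noteq> 0" using x0 by (simp add: inner_gram_mult)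
  then have "?N *v x0 \<noteq> 0" by auto
  then have nzV: "\<exists>x\<in>?V. x \<noteq> 0" using inV by blast
  have "transpose (- ?N) = - ?N"
    using symmetric_gram[of X] by (simp add: transpose_def vec_eq_iff)
  then obtain l v where v: "v \<in> ?V" "v \<noteq> 0" "(- ?N) *v v = l *\<^sub>R v"
    and le: "\<And>x. x \<in> ?V \<Longrightarrow> x \<bullet> ((- ?N) *v x) \<le> l * (x \<bullet> x)"
  proof (rule rayleigh_max_eigenvector[OF _ V nzV])
    show "(- ?N) *v x \<in> ?V" if "x \<in> ?V" for x
      unfolding neg by (intro subspace_neg V inV)
  qed (use that in blast)
  have ev: "?N *v v = (- l) *\<^sub>R v" using v(3) neg by (metis minus_minus scaleR_minus_left)
  have ge: "(- l) * (norm x)\<^sup>2 \<le> (norm (X *v x))\<^sup>2" if "x \<in> ?V" for x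
    using le[OF that] by (simp add: neg inner_gram_mult dot_square_norm)
  have "- l \<noteq> 0"
  proof
    assume "- l = 0"
    then have "(X *v v) \<bullet> (X *v v) = 0" using inner_gram_mult[of v X v] ev by simp
    then show False using inj v by simp
  qed
  then have "- l \<in> eigenvalues ?N - {0}" using ev v(2) by (auto simp: eigenvalues_def)
  then show thesis using that ge by blast
qed

text \<open>
  Zero may or may not be an eigenvalue of \<open>X ** transpose X\<close>, but never is the largest one, as
  the others are positive.
\<close>

lemma gram_extreme_eigenvalues:
  fixes X :: "real^'q^'k"
  assumes nz: "\<exists>x. X *v x \<noteq> 0"
  shows largest_eigenvalue_gram_pos: "0 < largest_eigenvalue (X ** transpose X)"
    and largest_eigenvalue_gram_le_iff:
      "largest_eigenvalue (X ** transpose X) \<le> c \<longleftrightarrow> (\<forall>x. (norm (X *v x))\<^sup>2 \<le> c * (norm x)\<^sup>2)"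
    and smallest_nonzero_eigenvalue_gram_pos: "0 < smallest_nonzero_eigenvalue (X ** transpose X)"
    and le_smallest_nonzero_eigenvalue_gram_iff:
      "t \<le> smallest_nonzero_eigenvalue (X ** transpose X) \<longleftrightarrow>
         (\<forall>x \<in> range ((*v) (transpose X)). t * (norm x)\<^sup>2 \<le> (norm (X *v x))\<^sup>2)"
proof -
  define E where "E = eigenvalues (transpose X ** X) - {0}"
  have E: "E = eigenvalues (X ** transpose X) - {0}"
    unfolding E_def by (rule eigenvalues_mult_commute)
  have finA: "finite (eigenvalues (X ** transpose X))"
    by (rule finite_eigenvalues_symmetric) (simp add: matrix_transpose_mul)
  then have fin: "finite E" by (simp add: E)
  obtain b where b: "b \<in> E" "\<And>x. (norm (X *v x))\<^sup>2 \<le> b * (norm x)\<^sup>2"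
    using gram_max_eigenvalue[OF nz] unfolding E_def by blast
  obtain a where a: "a \<in> E"
    "\<And>x. x \<in> range ((*v) (transpose X)) \<Longrightarrow> a * (norm x)\<^sup>2 \<le> (norm (X *v x))\<^sup>2"
    using gram_min_eigenvalue[OF nz] unfolding E_def by blast
  have ne: "E \<noteq> {}" using a by blast
  have pos: "0 < l" if "l \<in> E" for l
    using gram_eigenvalue_pos that unfolding E_def by blast
  have max: "largest_eigenvalue (X ** transpose X) = Max E"
    unfolding largest_eigenvalue_def
  proof (rule Max_eqI[OF finA])
    show "y \<le> Max E" if "y \<in> eigenvalues (X ** transpose X)" for y
      using that fin ne pos[OF Max_in[OF fin ne]] E by (cases "y = 0") auto
    show "Max E \<in> eigenvalues (X ** transpose X)"
      using Max_in[OF fin ne] E by blast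
  qed
  have min: "smallest_nonzero_eigenvalue (X ** transpose X) = Min E"
    by (simp add: smallest_nonzero_eigenvalue_def E)
  show "0 < largest_eigenvalue (X ** transpose X)"
    unfolding max by (rule pos[OF Max_in[OF fin ne]])
  show "0 < smallest_nonzero_eigenvalue (X ** transpose X)"
    unfolding min by (rule pos[OF Min_in[OF fin ne]])
  show "largest_eigenvalue (X ** transpose X) \<le> c \<longleftrightarrow>
      (\<forall>x. (norm (X *v x))\<^sup>2 \<le> c * (norm x)\<^sup>2)"
    unfolding max Max_le_iff[OF fin ne]
  proof (intro iffI allI ballI)
    fix x assume "\<forall>l\<in>E. l \<le> c"
    then show "(norm (X *v x))\<^sup>2 \<le> c * (norm x)\<^sup>2"
      using b(1) by (intro order_trans[OF b(2)] mult_right_mono) auto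
  next
    fix l assume le: "\<forall>x. (norm (X *v x))\<^sup>2 \<le> c * (norm x)\<^sup>2" and "l \<in> E"
    then obtain v where v: "v \<noteq> 0" "(norm (X *v v))\<^sup>2 = l * (norm v)\<^sup>2"
      using gram_eigenvector unfolding E_def by metis
    have "l * (norm v)\<^sup>2 \<le> c * (norm v)\<^sup>2" using le[rule_format, of v] v(2) by simp
    then show "l \<le> c" using v(1) by simp
  qed
  show "t \<le> smallest_nonzero_eigenvalue (X ** transpose X) \<longleftrightarrow>
         (\<forall>x \<in> range ((*v) (transpose X)). t * (norm x)\<^sup>2 \<le> (norm (X *v x))\<^sup>2)"
    unfolding min Min_ge_iff[OF fin ne]
  proof (intro iffI ballI)
    fix x assume "\<forall>l\<in>E. t \<le> l" "x \<in> range ((*v) (transpose X))"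
    then show "t * (norm x)\<^sup>2 \<le> (norm (X *v x))\<^sup>2"
      using a(1) by (intro order_trans[OF _ a(2)] mult_right_mono) auto
  next
    fix l assume ge: "\<forall>x \<in> range ((*v) (transpose X)). t * (norm x)\<^sup>2 \<le> (norm (X *v x))\<^sup>2"
      and "l \<in> E"
    then obtain v where v: "v \<noteq> 0" "(norm (X *v v))\<^sup>2 = l * (norm v)\<^sup>2"
      "v \<in> range ((*v) (transpose X))"
      using gram_eigenvector unfolding E_def by metis
    have "t * (norm v)\<^sup>2 \<le> l * (norm v)\<^sup>2" using ge[rule_format, OF v(3)] v(2) by simp
    then show "t \<le> l" using v(1) by simp
  qed
qed

section \<open>Matrix inequalities as norm bounds\<close>

lemma gram_loewner_le_iff:
  fixes X :: "real^'q^'k"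
  shows "transpose X ** X \<preceq> mat 1 \<longleftrightarrow> (\<forall>x. (norm (X *v x))\<^sup>2 \<le> (norm x)\<^sup>2)"
proof -
  have "transpose (mat 1 - transpose X ** X) = mat 1 - transpose X ** X"
    using symmetric_gram[of X] by (simp add: transpose_def vec_eq_iff mat_def)
  moreover have "x \<bullet> ((mat 1 - transpose X ** X) *v x) = (norm x)\<^sup>2 - (norm (X *v x))\<^sup>2" for x
    by (simp add: matrix_vector_mult_diff_rdistrib inner_diff_right inner_gram_mult dot_square_norm)
  ultimately show ?thesis by (simp add: loewner_le_def psd_def)
qed

lemma loewner_le_gram_iff:
  fixes X :: "real^'q^'k"
  shows "t *\<^sub>R mat 1 \<preceq> transpose X ** X \<longleftrightarrow> (\<forall>x. t * (norm x)\<^sup>2 \<le> (norm (X *v x))\<^sup>2)"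
proof -
  have "transpose (transpose X ** X - t *\<^sub>R mat 1) = transpose X ** X - t *\<^sub>R mat 1"
    using symmetric_gram[of X] by (simp add: transpose_def vec_eq_iff mat_def)
  moreover have "x \<bullet> ((transpose X ** X - t *\<^sub>R mat 1) *v x) = (norm (X *v x))\<^sup>2 - t * (norm x)\<^sup>2"
    for x
    by (simp add: matrix_vector_mult_diff_rdistrib inner_diff_right inner_gram_mult dot_square_norm
        scaleR_matrix_vector_assoc[symmetric])
  ultimately show ?thesis by (simp add: loewner_le_def psd_def)
qed

lemma contraction_transpose:
  fixes X :: "real^'q^'k"
  assumes "\<And>x. norm (X *v x) \<le> norm x"
  shows "norm (transpose X *v y) \<le> norm y"
proof -
  let ?z = "transpose X *v y"
  have "(norm ?z)\<^sup>2 = (X *v ?z) \<bullet> y"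
    by (simp add: inner_transpose_mult[symmetric] dot_square_norm)
  also have "\<dots> \<le> norm (X *v ?z) * norm y" by (rule norm_cauchy_schwarz)
  also have "\<dots> \<le> norm ?z * norm y" by (intro mult_right_mono assms) simp
  finally show ?thesis
    by (cases "norm ?z = 0") (simp_all add: power2_eq_square)
qed

lemma orthonormal_basis_isometry:
  fixes \<Phi> :: "real^'r^'q"
  assumes "orthonormal_basis_of \<Phi> V"
  shows "norm (\<Phi> *v z) = norm z" and "range ((*v) \<Phi>) = V"
proof -
  have "transpose \<Phi> ** \<Phi> = mat 1"
    using assms unfolding orthonormal_basis_of_def
    by (simp add: vec_eq_iff matrix_matrix_mult_def transpose_def mat_def column_def inner_vec_def)
  then have "(\<Phi> *v z) \<bullet> (\<Phi> *v z) = z \<bullet> z"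
    using inner_gram_mult[of z \<Phi> z] by simp
  then show "norm (\<Phi> *v z) = norm z" by (simp add: norm_eq)
  have "subspace (range ((*v) \<Phi>))"
    by (rule linear_subspace_image[OF _ subspace_UNIV]) simp
  then have "span (columns \<Phi>) \<subseteq> range ((*v) \<Phi>)"
    by (intro span_minimal) (auto simp: columns_image_basis)
  moreover have "range ((*v) \<Phi>) \<subseteq> span (columns \<Phi>)"
    using matrix_vector_mult_in_columnspace by blast
  ultimately show "range ((*v) \<Phi>) = V"
    using assms by (auto simp: orthonormal_basis_of_def)
qed

section \<open>The structured set and its factors\<close>

lemma invertible_gram_iff:
  fixes D :: "real^'k^'k"
  shows "invertible (transpose D ** D) \<longleftrightarrow> invertible D"
  by (simp add: invertible_det_nz det_mul det_transpose)

lemma matrix_inv_involutive: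
  fixes A :: "real^'k^'k"
  assumes "invertible A"
  shows "matrix_inv (matrix_inv A) = A"
  by (rule matrix_inv_eqI[OF matrix_inv_both(2)[OF assms]])

lemma matrix_inv_gram:
  fixes D :: "real^'k^'k"
  assumes "invertible D"
  shows "matrix_inv (transpose D ** D) = matrix_inv D ** transpose (matrix_inv D)"
proof (rule matrix_inv_eqI)
  have "(transpose D ** D) ** (matrix_inv D ** transpose (matrix_inv D))
      = transpose D ** (D ** matrix_inv D) ** transpose (matrix_inv D)"
    by (simp only: matrix_mul_assoc)
  also have "\<dots> = transpose (matrix_inv D ** D)"
    unfolding matrix_transpose_mul by (simp add: matrix_inv_both(1)[OF assms])
  finally show "(transpose D ** D) ** (matrix_inv D ** transpose (matrix_inv D)) = mat 1"
    by (simp add: matrix_inv_both[OF assms])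
qed

lemma structured_imp_gram:
  fixes M :: "real^'k^'k"
  assumes "M \<in> structured S"
  obtains D :: "real^'k^'k" where "M = transpose D ** D"
proof -
  obtain D :: "real^'k^'k" where "invertible D" "M = matrix_inv (transpose D ** D)"
    using assms unfolding structured_def by blast
  then show thesis
    using that[of "transpose (matrix_inv D)"] by (simp add: matrix_inv_gram)
qed

lemma structured_imp_invertible:
  fixes M :: "real^'k^'k"
  assumes "M \<in> structured S"
  shows "invertible M"
proof -
  obtain D :: "real^'k^'k" where D: "invertible D" "M = matrix_inv (transpose D ** D)"
    using assms unfolding structured_def by blast
  then have "invertible (transpose D ** D)" by (simp add: invertible_gram_iff)
  from matrix_inv_both[OF this] show ?thesis unfolding D(2) invertible_def by blast
qed

lemma scaleR_matrix_mult:
  fixes A :: "real^'n^'m" and B :: "real^'p^'n"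
  shows "(a *\<^sub>R A) ** B = a *\<^sub>R (A ** B)" "A ** (a *\<^sub>R B) = a *\<^sub>R (A ** B)"
  by (simp_all add: scalar_matrix_assoc matrix_scalar_ac)

lemma matrix_inv_scaleR:
  fixes A :: "real^'k^'k"
  assumes "invertible A" "c \<noteq> 0"
  shows "matrix_inv (c *\<^sub>R A) = (1 / c) *\<^sub>R matrix_inv A"
  by (rule matrix_inv_eqI) (simp add: scaleR_matrix_mult matrix_inv_both assms)

lemma structured_scaleR:
  fixes M :: "real^'k^'k"
  assumes M: "M \<in> structured S" and c: "c > 0"
  shows "c *\<^sub>R M \<in> structured S"
proof -
  obtain D where pd: "posdef M" and D: "invertible D" and MD: "M = matrix_inv (transpose D ** D)"
    and pat: "\<And>i j. (i, j) \<notin> S \<Longrightarrow>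
      M $ i $ j = 0 \<and> matrix_inv M $ i $ j = 0 \<and> matrix_inv D $ i $ j = 0"
    using M unfolding structured_def by blast
  define s where "s = 1 / sqrt c"
  have s: "s \<noteq> 0" "1 / (s * s) = c" using c by (simp_all add: s_def)
  have pd': "posdef (c *\<^sub>R M)"
    using pd c unfolding posdef_def
    by (simp add: transpose_scalar scaleR_matrix_vector_assoc[symmetric])
  have D': "invertible (s *\<^sub>R D)"
    using D s by (simp add: scalar_invertible)
  have MD': "c *\<^sub>R M = matrix_inv (transpose (s *\<^sub>R D) ** (s *\<^sub>R D))"
    using s D matrix_inv_scaleR[of "transpose D ** D" "s * s"]
    by (simp add: MD transpose_scalar scaleR_matrix_mult invertible_gram_iff)
  have "matrix_inv (c *\<^sub>R M) = (1 / c) *\<^sub>R matrix_inv M"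
    using structured_imp_invertible[OF M] c by (simp add: matrix_inv_scaleR)
  moreover have "matrix_inv (s *\<^sub>R D) = (1 / s) *\<^sub>R matrix_inv D"
    using D s by (simp add: matrix_inv_scaleR)
  ultimately have "(c *\<^sub>R M) $ i $ j = 0 \<and> matrix_inv (c *\<^sub>R M) $ i $ j = 0 \<and>
      matrix_inv (s *\<^sub>R D) $ i $ j = 0" if "(i, j) \<notin> S" for i j
    using pat[OF that] by simp
  then show ?thesis
    unfolding structured_def using pd' D' MD' by blast
qed

lemma structured_scaleR_iff:
  fixes M :: "real^'k^'k"
  assumes "c > 0"
  shows "c *\<^sub>R M \<in> structured S \<longleftrightarrow> M \<in> structured S"
  using structured_scaleR[of M S c] structured_scaleR[of "c *\<^sub>R M" S "1 / c"] assms by auto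

text \<open>
  This is where closure under inversion enters: the ratio is minimized over the factors of
  inverses of structured matrices, the program ranges over structured matrices themselves.
\<close>

lemma admissible_iff_gram_structured:
  fixes D :: "real^'k^'k"
  assumes "inverse_closed S"
  shows "admissible S D \<longleftrightarrow> transpose D ** D \<in> structured S"
  using assms structured_imp_invertible[of "transpose D ** D" S]
    matrix_inv_involutive[of "transpose D ** D"]
  unfolding admissible_def inverse_closed_def by (metis invertible_gram_iff)

section \<open>The program in terms of eigenvalues\<close>

lemma range_transpose_factor:
  fixes D :: "real^'k^'k" and C :: "real^'n^'k" and Q :: "real^'n^'q"
  assumes "invertible D"
  shows "range ((*v) (transpose (D ** C ** transpose Q))) = range ((*v) (Q ** transpose C))"
proof -
  have "surj ((*v) (transpose D))"
    using transpose_invertible[OF assms]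
    by (metis invertible_def matrix_right_invertible_surjective)
  moreover have "(*v) (transpose (D ** C ** transpose Q)) = (*v) (Q ** transpose C) \<circ> (*v) (transpose D)"
    by (simp add: fun_eq_iff matrix_transpose_mul matrix_vector_mul_assoc matrix_mul_assoc)
  ultimately show ?thesis by (metis image_comp)
qed

text \<open>
  The parameter \<open>c\<close> serves two instances: \<open>c = 1\<close> describes the feasible points, and taking for
  \<open>c\<close> the largest eigenvalue normalizes a given \<open>M\<close> to a feasible one.
\<close>

lemma sdp_feasible_scaled_iff:
  fixes C :: "real^'n^'k" and Q :: "real^'n^'q" and \<Phi> :: "real^'r^'q" and D :: "real^'k^'k"
  defines "A \<equiv> D ** C ** (transpose Q ** Q) ** transpose C ** transpose D"
  assumes \<Phi>: "orthonormal_basis_of \<Phi> (range ((*v) (Q ** transpose C)))"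
    and D: "invertible D" and c: "c > 0"
  shows "sdp_feasible S C Q \<Phi> (t, (1 / c) *\<^sub>R (transpose D ** D)) \<longleftrightarrow>
           transpose D ** D \<in> structured S \<and>
           largest_eigenvalue A \<le> c \<and> t * c \<le> smallest_nonzero_eigenvalue A"
    and "0 < largest_eigenvalue A" and "0 < smallest_nonzero_eigenvalue A"
proof -
  define X where "X = D ** C ** transpose Q"
  define s where "s = 1 / sqrt c"
  have s: "s * s = 1 / c" "s\<^sup>2 = 1 / c" using c by (simp_all add: s_def power2_eq_square)
  have A: "A = X ** transpose X"
    by (simp add: A_def X_def matrix_transpose_mul matrix_mul_assoc)
  have ran: "range ((*v) (transpose X)) = range ((*v) (Q ** transpose C))"
    unfolding X_def by (rule range_transpose_factor[OF D])
  note iso = orthonormal_basis_isometry[OF \<Phi>]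
  have nz: "\<exists>x. X *v x \<noteq> 0"
  proof (rule ccontr)
    assume "\<not> ?thesis"
    \<comment> \<open>then the row space of \<open>X\<close> is trivial, but it contains the columns of \<open>\<Phi>\<close>\<close>
    then have "X = 0" by (simp add: matrix_eq)
    then have "range ((*v) \<Phi>) = {0}"
      using iso(2) ran by (auto simp: transpose_def matrix_vector_mult_def zero_vec_def)
    then have "norm (axis undefined 1 :: real^'r) = 0"
      using iso(1)[of "axis undefined 1"] by (metis rangeI singletonD norm_zero)
    then show False by simp
  qed
  show "0 < largest_eigenvalue A" "0 < smallest_nonzero_eigenvalue A"
    unfolding A
    by (rule largest_eigenvalue_gram_pos[OF nz] smallest_nonzero_eigenvalue_gram_pos[OF nz])+
  let ?M = "(1 / c) *\<^sub>R (transpose D ** D)"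
  have "Q ** transpose C ** ?M ** C ** transpose Q = transpose (s *\<^sub>R X) ** (s *\<^sub>R X)"
    by (simp add: X_def scaleR_matrix_mult transpose_scalar s matrix_transpose_mul matrix_mul_assoc)
  moreover have "(norm ((s *\<^sub>R X) *v x))\<^sup>2 \<le> (norm x)\<^sup>2 \<longleftrightarrow>
      (norm (X *v x))\<^sup>2 \<le> c * (norm x)\<^sup>2" for x
    using c by (simp add: scaleR_matrix_vector_assoc[symmetric] power_mult_distrib s field_simps)
  ultimately have up: "Q ** transpose C ** ?M ** C ** transpose Q \<preceq> mat 1 \<longleftrightarrow>
      largest_eigenvalue A \<le> c"
    by (simp only: gram_loewner_le_iff A largest_eigenvalue_gram_le_iff[OF nz])
  have "transpose \<Phi> ** Q ** transpose C ** ?M ** C ** transpose Q ** \<Phi>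
      = transpose (s *\<^sub>R (X ** \<Phi>)) ** (s *\<^sub>R (X ** \<Phi>))"
    by (simp add: X_def scaleR_matrix_mult transpose_scalar s matrix_transpose_mul matrix_mul_assoc)
  moreover have "t * (norm z)\<^sup>2 \<le> (norm ((s *\<^sub>R (X ** \<Phi>)) *v z))\<^sup>2 \<longleftrightarrow>
      t * c * (norm (\<Phi> *v z))\<^sup>2 \<le> (norm (X *v (\<Phi> *v z)))\<^sup>2" for z
    using c by (simp add: scaleR_matrix_vector_assoc[symmetric] matrix_vector_mul_assoc[symmetric]
        power_mult_distrib s iso(1) field_simps)
  moreover have "(\<forall>z. t * c * (norm (\<Phi> *v z))\<^sup>2 \<le> (norm (X *v (\<Phi> *v z)))\<^sup>2) \<longleftrightarrow>
      (\<forall>x \<in> range ((*v) (transpose X)). t * c * (norm x)\<^sup>2 \<le> (norm (X *v x))\<^sup>2)"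
    unfolding ran iso(2)[symmetric] by blast
  ultimately have low:
    "t *\<^sub>R mat 1 \<preceq> transpose \<Phi> ** Q ** transpose C ** ?M ** C ** transpose Q ** \<Phi> \<longleftrightarrow>
      t * c \<le> smallest_nonzero_eigenvalue A"
    by (simp only: loewner_le_gram_iff A le_smallest_nonzero_eigenvalue_gram_iff[OF nz])
  show "sdp_feasible S C Q \<Phi> (t, ?M) \<longleftrightarrow> transpose D ** D \<in> structured S \<and>
      largest_eigenvalue A \<le> c \<and> t * c \<le> smallest_nonzero_eigenvalue A"
    unfolding sdp_feasible_def prod.case up low
    using structured_scaleR_iff[of "1 / c" "transpose D ** D" S] c
    by (simp only: zero_less_divide_1_iff) blast
qed

text \<open>
  The congruence by \<open>matrix_inv D\<close> turns \<open>X ** transpose X \<preceq> mat 1\<close> into the claim; here it is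
  carried out on vectors, with \<open>y\<close> replaced by \<open>transpose D *v (transpose (matrix_inv D) *v y)\<close>.
\<close>

lemma loewner_le_matrix_inv_gram:
  fixes C :: "real^'n^'k" and Q :: "real^'n^'q" and D :: "real^'k^'k"
  assumes le: "Q ** transpose C ** (transpose D ** D) ** C ** transpose Q \<preceq> mat 1"
    and D: "invertible D"
  shows "C ** (transpose Q ** Q) ** transpose C \<preceq> matrix_inv (transpose D ** D)"
proof -
  define X where "X = D ** C ** transpose Q"
  define E where "E = matrix_inv D"
  have "Q ** transpose C ** (transpose D ** D) ** C ** transpose Q = transpose X ** X"
    by (simp add: X_def matrix_transpose_mul matrix_mul_assoc)
  then have "norm (X *v x) \<le> norm x" for x
    using le gram_loewner_le_iff[of X] by simp
  then have contr: "norm (transpose X *v y) \<le> norm y" for y by (rule contraction_transpose)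
  have "transpose D ** transpose E = transpose (E ** D)" by (simp add: matrix_transpose_mul)
  then have DE: "transpose D ** transpose E = mat 1"
    by (simp add: E_def matrix_inv_both[OF D])
  define Y where "Y = Q ** transpose C"
  have YX: "Y *v y = transpose X *v (transpose E *v y)" for y
  proof -
    have "transpose X ** transpose E = Y ** (transpose D ** transpose E)"
      by (simp add: X_def Y_def matrix_transpose_mul matrix_mul_assoc)
    then show ?thesis by (simp add: DE matrix_vector_mul_assoc)
  qed
  let ?G = "transpose (transpose E) ** transpose E - transpose Y ** Y"
  have "transpose ?G = ?G"
    using symmetric_gram[of "transpose E"] symmetric_gram[of Y]
    by (simp add: transpose_def vec_eq_iff)
  moreover have "0 \<le> y \<bullet> (?G *v y)" for y
    using contr[of "transpose E *v y"]
    by (simp only: matrix_vector_mult_diff_rdistrib inner_diff_right inner_gram_mult dot_square_norm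
        YX power_mono norm_ge_zero diff_ge_0_iff_ge)
  moreover have "matrix_inv (transpose D ** D) - C ** (transpose Q ** Q) ** transpose C = ?G"
    by (simp add: matrix_inv_gram[OF D] E_def Y_def matrix_transpose_mul matrix_mul_assoc)
  ultimately show ?thesis by (simp add: loewner_le_def psd_def)
qed

theorem proposition26:
  fixes C :: "real^'n^'k" and P :: "real^'n^'n" and Q :: "real^'n^'q"
    and \<Phi> :: "real^'r^'q" and S :: "('k \<times> 'k) set"
  assumes "rank (Q ** transpose C ** C ** transpose Q) = CARD('r)"
    and "CARD('r) < min CARD('k) CARD('q)"
    and "psd P"
    and "P = transpose Q ** Q"
    and "rank Q = CARD('q)"
    and "orthonormal_basis_of \<Phi> (range ((*v) (Q ** transpose C)))"
    and "inverse_closed S"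
  shows "(\<forall>t M. sdp_optimal S C Q \<Phi> (t, M) \<longrightarrow>
            (\<exists>D :: real^'k^'k. M = transpose D ** D) \<and>
            (\<forall>D. M = transpose D ** D \<longrightarrow>
               minimizes_ratio S C P D \<and>
               C ** P ** transpose C \<preceq> matrix_inv (transpose D ** D)))
       \<and> ((\<exists>D. minimizes_ratio S C P D) \<longrightarrow> (\<exists>t M. sdp_optimal S C Q \<Phi> (t, M)))"
proof -
  define f where "f D = largest_eigenvalue (D ** C ** P ** transpose C ** transpose D)"
    for D :: "real^'k^'k"
  define g where "g D = smallest_nonzero_eigenvalue (D ** C ** P ** transpose C ** transpose D)"
    for D :: "real^'k^'k"
  have ratio: "eigenvalue_ratio C P D = f D / g D" for D
    by (simp add: eigenvalue_ratio_def f_def g_def Let_def)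
  have adm: "admissible S D \<longleftrightarrow> transpose D ** D \<in> structured S" for D
    by (rule admissible_iff_gram_structured[OF assms(7)])
  have inv: "invertible D" if "admissible S D" for D using that by (simp add: admissible_def)
  note sdp = sdp_feasible_scaled_iff[OF assms(6), folded assms(4), folded f_def g_def]
  have f: "0 < f D" and g: "0 < g D" if "admissible S D" for D
    using sdp(2,3)[OF inv[OF that], of 1] by simp_all
  have feasible: "sdp_feasible S C Q \<Phi> (t, transpose D ** D) \<longleftrightarrow> f D \<le> 1 \<and> t \<le> g D"
    if "admissible S D" for t D
    using sdp(1)[OF inv[OF that], of 1 S t] that adm by simp
  have normalized: "sdp_feasible S C Q \<Phi> (g D / f D, (1 / f D) *\<^sub>R (transpose D ** D))"
    if "admissible S D" for D
    using sdp(1)[OF inv[OF that] f[OF that], of S "g D / f D"] that adm f[OF that] by simp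
  have bound: "t \<le> g D / f D"
    if "admissible S D" "sdp_feasible S C Q \<Phi> (t, transpose D ** D)" for t D
  proof -
    have "f D \<le> 1" "t \<le> g D" using feasible that by auto
    moreover have "g D \<le> g D / f D" using f g that \<open>f D \<le> 1\<close> by (simp add: pos_le_divide_eq)
    ultimately show ?thesis by simp
  qed
  have flip: "f D / g D \<le> f D' / g D' \<longleftrightarrow> g D' / f D' \<le> g D / f D"
    if "admissible S D" "admissible S D'" for D D'
    using f[OF that(1)] g[OF that(1)] f[OF that(2)] g[OF that(2)]
    by (simp add: divide_simps mult.commute)
  have "minimizes_ratio S C P D \<and> C ** P ** transpose C \<preceq> matrix_inv (transpose D ** D)"
    if opt: "sdp_optimal S C Q \<Phi> (t, transpose D ** D)" for t and D :: "real^'k^'k"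
  proof
    have feas: "sdp_feasible S C Q \<Phi> (t, transpose D ** D)"
      and best: "\<And>t' M'. sdp_feasible S C Q \<Phi> (t', M') \<Longrightarrow> t' \<le> t"
      using opt unfolding sdp_optimal_def is_arg_min_def by (auto simp: not_less)
    have ad: "admissible S D" using feas adm by (simp add: sdp_feasible_def)
    have "g D' / f D' \<le> g D / f D" if "admissible S D'" for D'
      using best[OF normalized[OF that]] bound[OF ad feas] by simp
    then show "minimizes_ratio S C P D"
      using ad flip unfolding minimizes_ratio_def is_arg_min_def ratio by (meson not_less)
    show "C ** P ** transpose C \<preceq> matrix_inv (transpose D ** D)"
      unfolding assms(4)
      by (rule loewner_le_matrix_inv_gram[OF _ inv[OF ad]]) (use feas in \<open>simp add: sdp_feasible_def\<close>)
  qed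
  moreover have "\<exists>D :: real^'k^'k. M = transpose D ** D" if "sdp_optimal S C Q \<Phi> (t, M)" for t M
    using that structured_imp_gram[of M S]
    unfolding sdp_optimal_def is_arg_min_def sdp_feasible_def by auto
  moreover have "sdp_optimal S C Q \<Phi> (g D / f D, (1 / f D) *\<^sub>R (transpose D ** D))"
    if "minimizes_ratio S C P D" for D
  proof -
    have ad: "admissible S D"
      and best: "\<And>D'. admissible S D' \<Longrightarrow> f D / g D \<le> f D' / g D'"
      using that unfolding minimizes_ratio_def is_arg_min_def ratio by (auto simp: not_less)
    have "t' \<le> g D / f D" if feas: "sdp_feasible S C Q \<Phi> (t', M')" for t' M'
    proof -
      have st: "M' \<in> structured S" using feas by (simp add: sdp_feasible_def)
      then obtain D' :: "real^'k^'k" where D': "M' = transpose D' ** D'"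
        by (rule structured_imp_gram)
      have ad': "admissible S D'" using st adm D' by simp
      show ?thesis using bound[OF ad'] feas D' best[OF ad'] flip[OF ad ad'] by force
    qed
    then show ?thesis
      using normalized[OF ad] unfolding sdp_optimal_def is_arg_min_def by (auto simp: not_less)
  qed
  ultimately show ?thesis by blast
qed

end
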